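(* Let $\phi\in L^1(\mathbb T)$ and $n\in\mathbb N$. Assume that the solution $X(z;n)$ of the $X$-Riemann--Hilbert problem and the solution $Z(z;n)$ of the $Z$-Riemann--Hilbert problem (both defined in the context) exist. Then $$Z(z;n)=\left(\begin{bmatrix}\dfrac{\overset{\infty}{X}_{1,12}(n)\,X_{21}(0;n)}{X_{11}(0;n)}&-\overset{\infty}{X}_{1,12}(n)\\[8pt]-\dfrac{X_{21}(0;n)}{X_{11}(0;n)}&1\end{bmatrix}z^{-1}+\begin{bmatrix}1&0\\0&0\end{bmatrix}\right)X(z;n)\begin{bmatrix}1&0\\0&z\end{bmatrix},$$ where $\overset{\infty}{X}_{1,12}(n)$ is the $12$-entry of the matrix $\overset{\infty}{X}_1(n)$ in the expansion of $X(z;n)$ as $z\to\infty$.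
   Context: $\mathbb T$ is the unit circle oriented counterclockwise; $\sigma_3=\mathrm{diag}(1,-1)$, so $z^{n\sigma_3}=\mathrm{diag}(z^n,z^{-n})$. The subscripts $+$ and $-$ denote limits at points of $\mathbb T$ from the inside and the outside of the unit circle respectively. $X$-Riemann--Hilbert problem: find $X(\cdot;n):\mathbb C\setminus\mathbb T\to\mathbb C^{2\times2}$ such that (1) $X(\cdot;n)$ is analytic; (2) the limits $X_\pm(z;n)$ exist, are continuous on $\mathbb T$, and satisfy $X_+(z;n)=X_-(z;n)\begin{bmatrix}1&z^{-n}\phi(z)\\0&1\end{bmatrix}$ for $z\in\mathbb T$; (3) as $z\to\infty$, $X(z;n)=\left(I+\frac{\overset{\infty}{X}_1(n)}{z}+\frac{\overset{\infty}{X}_2(n)}{z^2}+O(z^{-3})\right)z^{n\sigma_3}$. $Z$-Riemann--Hilbert problem: the same with $\phi$ replaced by $z\phi$, i.e. find $Z(\cdot;n):\mathbb C\setminus\mathbb T\to\mathbb C^{2\times2}$ such that (1) $Z(\cdot;n)$ is analytic; (2) the limits $Z_\pm(z;n)$ exist, are continuous on $\mathbb T$, and satisfy $Z_+(z;n)=Z_-(z;n)\begin{bmatrix}1&z^{-n+1}\phi(z)\\0&1\end{bmatrix}$ for $z\in\mathbb T$; (3) $Z(z;n)=(I+O(z^{-1}))z^{n\sigma_3}$ as $z\to\infty$. *)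

theory Defs
  imports "HOL-Analysis.Analysis" "HOL-Library.Landau_Symbols"
begin

type_synonym cmat2 = "complex^2^2"

definition mat2 :: "complex \<Rightarrow> complex \<Rightarrow> complex \<Rightarrow> complex \<Rightarrow> cmat2" where
  "mat2 a b c d = vector [vector [a, b], vector [c, d]]"

text \<open>The library scales matrices by reals only; this is scaling by a complex number.\<close>

definition cscale :: "complex \<Rightarrow> cmat2 \<Rightarrow> cmat2" (infixr \<open>\<cdot>\<^sub>m\<close> 75) where
  "c \<cdot>\<^sub>m A = (\<chi> i j. c * A $ i $ j)"

abbreviation unit_circle :: "complex set" where
  "unit_circle \<equiv> sphere 0 1"

text \<open>The symbol of class $L^1$ on the circle, and ``almost every point of the circle'', both
  with respect to arc length in the parametrisation \<open>t \<mapsto> cis t\<close>.\<close>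

definition L1_circle :: "(complex \<Rightarrow> complex) \<Rightarrow> bool" where
  "L1_circle \<phi> \<longleftrightarrow> (\<lambda>t. \<phi> (cis t)) absolutely_integrable_on {0..2 * pi}"

definition ae_circle :: "(complex \<Rightarrow> bool) \<Rightarrow> bool" where
  "ae_circle P \<longleftrightarrow> (AE t in lebesgue. t \<in> {0..2 * pi} \<longrightarrow> P (cis t))"

definition analytic_off_circle :: "(complex \<Rightarrow> cmat2) \<Rightarrow> bool" where
  "analytic_off_circle Y \<longleftrightarrow> (\<forall>i j. (\<lambda>z. Y z $ i $ j) analytic_on - unit_circle)"

text \<open>\<open>Yp\<close> and \<open>Ym\<close> are the limits of \<open>Y\<close> from the inside (+) and from the outside (-); the
  approach within either region is unrestricted.\<close>

definition boundary_values ::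
  "(complex \<Rightarrow> cmat2) \<Rightarrow> (complex \<Rightarrow> cmat2) \<Rightarrow> (complex \<Rightarrow> cmat2) \<Rightarrow> bool" where
  "boundary_values Y Yp Ym \<longleftrightarrow>
     (\<forall>z\<in>unit_circle. (Y \<longlongrightarrow> Yp z) (at z within ball 0 1)) \<and>
     (\<forall>z\<in>unit_circle. (Y \<longlongrightarrow> Ym z) (at z within - cball 0 1)) \<and>
     continuous_on unit_circle Yp \<and> continuous_on unit_circle Ym"

definition zpow_sigma3 :: "nat \<Rightarrow> complex \<Rightarrow> cmat2" where
  "zpow_sigma3 n z = mat2 (z ^ n) 0 0 (z powi (- int n))"

definition mat_bigo_infinity :: "(complex \<Rightarrow> cmat2) \<Rightarrow> nat \<Rightarrow> bool" where
  "mat_bigo_infinity E k \<longleftrightarrow> (\<forall>i j. (\<lambda>z. E z $ i $ j) \<in> O[at_infinity](\<lambda>z. 1 / z ^ k))"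

text \<open>Since \<open>\<phi>\<close> represents an $L^1$ class, the jump relations are required almost everywhere on
  the circle, so that they do not depend on the representative. The coefficients \<open>X1\<close>, \<open>X2\<close> of the
  expansion at infinity are determined by \<open>X\<close>.\<close>

definition X_RHP ::
  "(complex \<Rightarrow> complex) \<Rightarrow> nat \<Rightarrow> (complex \<Rightarrow> cmat2) \<Rightarrow> cmat2 \<Rightarrow> cmat2 \<Rightarrow> bool" where
  "X_RHP \<phi> n X X1 X2 \<longleftrightarrow>
     analytic_off_circle X \<and>
     (\<exists>Xp Xm. boundary_values X Xp Xm \<and>
        ae_circle (\<lambda>z. Xp z = Xm z ** mat2 1 (z powi (- int n) * \<phi> z) 0 1)) \<and>
     (\<exists>E. mat_bigo_infinity E 3 \<and>
        (\<forall>\<^sub>F z in at_infinity.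
           X z = (mat 1 + (1 / z) \<cdot>\<^sub>m X1 + (1 / z\<^sup>2) \<cdot>\<^sub>m X2 + E z) ** zpow_sigma3 n z))"

definition Z_RHP :: "(complex \<Rightarrow> complex) \<Rightarrow> nat \<Rightarrow> (complex \<Rightarrow> cmat2) \<Rightarrow> bool" where
  "Z_RHP \<phi> n Z \<longleftrightarrow>
     analytic_off_circle Z \<and>
     (\<exists>Zp Zm. boundary_values Z Zp Zm \<and>
        ae_circle (\<lambda>z. Zp z = Zm z ** mat2 1 (z powi (- int n + 1) * \<phi> z) 0 1)) \<and>
     (\<exists>E. mat_bigo_infinity E 1 \<and>
        (\<forall>\<^sub>F z in at_infinity. Z z = (mat 1 + E z) ** zpow_sigma3 n z))"

end

theory Submission
  imports Defs "HOL-Complex_Analysis.Conformal_Mappings"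
begin

text \<open>Right multiplication of $X$ by $\mathrm{diag}(1,z)$ produces the jump of $Z$, so
  $z\,Z(z)\,(X(z)\,\mathrm{diag}(1,z))^{-1} = Z(z)\,\mathrm{diag}(z,1)\,\mathrm{adj}\,X(z)$ has
  no jump and extends to an entire function; here $\det X = 1$, by the same argument. The
  expansions at infinity and Liouville's theorem leave a matrix polynomial of degree one whose
  second column is $(-X_{1,12}, 1)^T$ and whose first column is known up to two constants. At
  $z = 0$ the factor $\mathrm{diag}(0,1)$ has rank one; this determines the constants and shows
  $X_{11}(0) \ne 0$.\<close>

section \<open>Removing the circle when the boundary values agree\<close>

text \<open>A nonempty open set of parameters has positive measure, so an exceptional null set
  cannot contain one. The jump relations themselves involve a merely integrable
  \<open>\<phi>\<close>; this applies only after \<open>\<phi>\<close> has cancelled and both sides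
  are continuous.\<close>

lemma ae_circle_eq_imp_eq:
  fixes f g :: "complex \<Rightarrow> complex"
  assumes f: "continuous_on unit_circle f" and g: "continuous_on unit_circle g"
    and ae: "ae_circle (\<lambda>z. f z = g z)" and z: "z \<in> unit_circle"
  shows "f z = g z"
proof -
  define u where "u t = f (cis t) - g (cis t)" for t
  have cu: "continuous_on A u" for A
    unfolding u_def
    by (intro continuous_intros continuous_on_compose2[OF f] continuous_on_compose2[OF g]) auto
  define B where "B = {t \<in> {0<..<2 * pi}. u t \<noteq> 0}"
  have "open B"
    unfolding B_def Collect_conj_eq Collect_mem_eq
    by (intro open_Int open_greaterThanLessThan open_Collect_neq cu continuous_on_const)
  have "AE t in lebesgue. t \<notin> B"
    using ae unfolding ae_circle_def by eventually_elim (auto simp: B_def u_def)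
  then have "negligible B"
    by (simp add: negligible_iff_null_sets AE_iff_null_sets borel_open \<open>open B\<close>)
  then have "B = {}"
    using open_not_negligible \<open>open B\<close> by blast
  then have u0: "u t = 0" if "t \<in> {0<..<2 * pi}" for t
    using that by (auto simp: B_def)
  have clos: "closure {0<..<2 * pi} = {0..2 * pi}"
    by (simp add: closure_greaterThanLessThan)
  obtain t where t: "0 \<le> t" "t \<le> 2 * pi" "z = cis t"
  proof -
    have "z = cis (Arg2pi z)"
      using z Arg2pi_eq[of z] by (simp add: cis_conv_exp)
    then show thesis
      using that Arg2pi_ge_0 Arg2pi_lt_2pi by (metis less_imp_le)
  qed
  \<comment> \<open>The parameter may be the endpoint 0 (the point z = 1), which the open interval
    misses; continuity reaches it.\<close>
  have "u t = 0"
  proof (rule continuous_constant_on_closure[where S = "{0<..<2 * pi}"])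
    show "t \<in> closure {0<..<2 * pi}"
      unfolding clos using t by simp
  qed (fact cu u0)+
  then show ?thesis
    using t by (simp add: u_def)
qed

text \<open>The exponential unrolls the circle to a line, where the pasting lemma of the library
  applies.\<close>

lemma holomorphic_across_circle:
  assumes cont: "continuous_on UNIV g" and hol: "g holomorphic_on - unit_circle"
  shows "g holomorphic_on UNIV"
proof -
  define h where "h w = g (exp (\<i> * w))" for w
  have "h holomorphic_on UNIV"
  proof (rule holomorphic_on_paste_across_line[where d = \<i> and k = 0])
    have *: "h holomorphic_on A" if "\<And>w. w \<in> A \<Longrightarrow> Im w \<noteq> 0" for A
      unfolding h_def using that
      by (intro holomorphic_on_compose_gen[OF _ hol, unfolded o_def] holomorphic_intros)
        auto
    show "h holomorphic_on UNIV \<inter> {z. \<i> \<bullet> z < 0}" "h holomorphic_on UNIV \<inter> {z. 0 < \<i> \<bullet> z}"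
      by (rule *; simp add: inner_complex_def)+
    show "continuous_on UNIV h"
      unfolding h_def by (intro continuous_on_compose2[OF cont] continuous_intros) auto
  qed auto
  have "g field_differentiable at p" for p
  proof (cases "p = 0")
    case True
    have "g holomorphic_on ball 0 1"
      using hol by (rule holomorphic_on_subset) auto
    then show ?thesis
      using True holomorphic_on_imp_differentiable_at[of g "ball 0 1" 0] by simp
  next
    case False
    \<comment> \<open>To return from \<open>h\<close> to \<open>g\<close>, invert the exponential
      near p. On the disc of radius |p| around p the quotient z / p stays within distance 1 of 1,
      hence off the cut of \<open>Ln\<close>. Thus Ln (z / p) + Ln p is a holomorphic logarithm of z
      there, wherever p lies, and \<open>f\<close> agrees with \<open>g\<close>.\<close>
    define f where "f z = h (- \<i> * (Ln (z / p) + Ln p))" for z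
    have pos: "z / p \<notin> \<real>\<^sub>\<le>\<^sub>0" if "z \<in> ball p (norm p)" for z
    proof
      assume "z / p \<in> \<real>\<^sub>\<le>\<^sub>0"
      then obtain r where r: "z = of_real r * p" "r \<le> 0"
        using False by (auto elim!: nonpos_Reals_cases simp: field_simps)
      have "p - z = of_real (1 - r) * p"
        by (simp add: r algebra_simps)
      then have "norm (p - z) = (1 - r) * norm p"
        using r by (simp add: norm_mult del: of_real_diff)
      moreover have "1 * norm p \<le> (1 - r) * norm p"
        using r by (intro mult_right_mono) auto
      ultimately show False
        using that by (simp add: dist_norm)
    qed
    have "f holomorphic_on ball p (norm p)"
      unfolding f_def using pos False
      by (intro holomorphic_on_compose_gen[OF _ \<open>h holomorphic_on UNIV\<close>, unfolded o_def]
          holomorphic_intros) auto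
    moreover have "f z = g z" if "z \<in> ball p (norm p)" for z
    proof -
      have "z \<noteq> 0"
        using that by auto
      then show ?thesis
        using False by (simp add: f_def h_def exp_add flip: mult.assoc)
    qed
    ultimately have "g holomorphic_on ball p (norm p)"
      using holomorphic_cong[of "ball p (norm p)" "ball p (norm p)" f g] by blast
    then show ?thesis
      using False holomorphic_on_imp_differentiable_at[of g "ball p (norm p)" p] by simp
  qed
  then show ?thesis
    by (simp add: holomorphic_on_def)
qed

text \<open>Filling in the common boundary values gives a function continuous on the whole plane: at
  a point of the circle, a neighbourhood splits into parts inside, outside and on the circle, and
  the limit is the same along each. A continuous function that is holomorphic off the circle is
  entire.\<close>

lemma entire_extension_across_circle:
  assumes an: "f analytic_on - unit_circle"
    and inner: "\<And>z. z \<in> unit_circle \<Longrightarrow> (f \<longlongrightarrow> fp z) (at z within ball 0 1)"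
    and outer: "\<And>z. z \<in> unit_circle \<Longrightarrow> (f \<longlongrightarrow> fm z) (at z within - cball 0 1)"
    and fp: "continuous_on unit_circle fp" and fm: "continuous_on unit_circle fm"
    and ae: "ae_circle (\<lambda>z. fp z = fm z)"
  shows "\<exists>g. g holomorphic_on UNIV \<and> (\<forall>z. z \<notin> unit_circle \<longrightarrow> g z = f z)"
proof -
  have eq: "fp z = fm z" if "z \<in> unit_circle" for z
    using ae_circle_eq_imp_eq[OF fp fm ae that] .
  define g where "g z = (if z \<in> unit_circle then fp z else f z)" for z
  have holf: "f holomorphic_on - unit_circle"
    using an by (rule analytic_imp_holomorphic)
  have holg: "g holomorphic_on - unit_circle"
    using holf by (rule holomorphic_transform) (auto simp: g_def)
  have "isCont g z" for z
  proof (cases "z \<in> unit_circle")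
    case False
    then have "z \<in> - unit_circle" "open (- unit_circle :: complex set)"
      by (auto intro: open_Compl)
    then show ?thesis
      using holg by (meson continuous_on_eq_continuous_at holomorphic_on_imp_continuous_on)
  next
    case True
    have "(g \<longlongrightarrow> g z) (at z within ball 0 1)"
      by (rule Lim_transform_within[OF inner[OF True] zero_less_one, THEN tendsto_eq_rhs])
        (use True in \<open>auto simp: g_def\<close>)
    moreover have "(g \<longlongrightarrow> g z) (at z within - cball 0 1)"
      by (rule Lim_transform_within[OF outer[OF True] zero_less_one, THEN tendsto_eq_rhs])
        (use True eq in \<open>auto simp: g_def\<close>)
    moreover have "(g \<longlongrightarrow> g z) (at z within unit_circle)"
      by (rule Lim_transform_within[OF fp[unfolded continuous_on, rule_format, OF True] zero_less_one,
            THEN tendsto_eq_rhs])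
        (use True in \<open>auto simp: g_def\<close>)
    ultimately have "(g \<longlongrightarrow> g z) (at z within (ball 0 1 \<union> - cball 0 1 \<union> unit_circle))"
      by (simp add: Lim_within_Un)
    also have "ball 0 1 \<union> - cball 0 1 \<union> unit_circle = (UNIV :: complex set)"
      by auto
    finally show ?thesis
      by (simp add: isCont_def)
  qed
  then have "g holomorphic_on UNIV"
    by (intro holomorphic_across_circle holg) (simp add: continuous_on_eq_continuous_at)
  moreover have "\<forall>z. z \<notin> unit_circle \<longrightarrow> g z = f z"
    by (simp add: g_def)
  ultimately show ?thesis
    by blast
qed

section \<open>Behaviour at infinity\<close>

text \<open>This form of Liouville's theorem serves the entries for which the expansion of
  \<open>Z\<close> supplies a bound but no limit.\<close>

lemma entire_bigo_1_constant:
  assumes "g holomorphic_on UNIV" and "g \<in> O[at_infinity](\<lambda>_. 1)"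
  shows "g z = g w"
proof -
  obtain c where "\<forall>\<^sub>F z in at_infinity. norm (g z) \<le> c * norm (1 :: complex)"
    using landau_o.bigE[OF assms(2)] by blast
  \<comment> \<open>The factor \<open>norm z ^ 0\<close> presents boundedness as polynomial growth
    of degree 0.\<close>
  then obtain A where "\<And>z. A \<le> norm z \<Longrightarrow> norm (g z) \<le> c * norm z ^ 0"
    unfolding eventually_at_infinity by auto
  then have "g \<xi> = (\<Sum>k\<le>0. (deriv ^^ k) g 0 / fact k * \<xi> ^ k)" for \<xi>
    by (rule Liouville_polynomial[OF assms(1)])
  then have "g \<xi> = g 0" for \<xi>
    by simp
  from this[of z] this[of w] show ?thesis
    by simp
qed

lemma bigo_1_imp_tendsto_0_at_infinity:
  fixes a :: "complex \<Rightarrow> complex"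
  assumes "(\<lambda>z. z * a z) \<in> O[at_infinity](\<lambda>_. 1)"
  shows "(a \<longlongrightarrow> 0) at_infinity"
proof -
  have "(\<lambda>z :: complex. 1 / z) \<in> o[at_infinity](\<lambda>_. 1)"
    using tendsto_inverse_0 by (intro smalloI_tendsto) (auto simp: divide_inverse)
  from landau_o.small_big_mult[OF this assms]
  have "((\<lambda>z. 1 / z * (z * a z)) \<longlongrightarrow> 0) at_infinity"
    using smalloD_tendsto by fastforce
  then show ?thesis
    by (rule Lim_transform_eventually)
      (rule eventually_mono[OF eventually_not_equal_at_infinity[of 0]], simp)
qed

lemma eventually_off_circle_at_infinity:
  "\<forall>\<^sub>F z in at_infinity. z \<noteq> 0 \<and> z \<notin> unit_circle"
  by (rule eventually_at_infinityI[of 2]) auto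

section \<open>Entries of two by two matrices and the expansions entrywise\<close>

lemma mat2_nth [simp]:
  "mat2 a b c d $ 1 $ 1 = a" "mat2 a b c d $ 1 $ 2 = b"
  "mat2 a b c d $ 2 $ 1 = c" "mat2 a b c d $ 2 $ 2 = d"
  by (simp_all add: mat2_def)

lemma matrix_mult_2_nth: "(A ** B) $ i $ j = A $ i $ 1 * B $ 1 $ j + A $ i $ 2 * B $ 2 $ j"
  for A B :: cmat2
  by (simp add: matrix_matrix_mult_def sum_2)

lemma cscale_nth [simp]: "(c \<cdot>\<^sub>m A) $ i $ j = c * A $ i $ j"
  by (simp add: cscale_def)

lemma cmat2_eq_iff: "A = B \<longleftrightarrow> (\<forall>i. A $ i $ 1 = B $ i $ 1 \<and> A $ i $ 2 = B $ i $ 2)"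
  for A B :: cmat2
  by (auto simp: vec_eq_iff forall_2)

lemma boundary_valuesD:
  assumes "boundary_values Y Yp Ym"
  shows "z \<in> unit_circle \<Longrightarrow> ((\<lambda>z. Y z $ i $ j) \<longlongrightarrow> Yp z $ i $ j) (at z within ball 0 1)"
    and "z \<in> unit_circle \<Longrightarrow> ((\<lambda>z. Y z $ i $ j) \<longlongrightarrow> Ym z $ i $ j) (at z within - cball 0 1)"
    and "continuous_on unit_circle (\<lambda>z. Yp z $ i $ j)"
    and "continuous_on unit_circle (\<lambda>z. Ym z $ i $ j)"
  using assms unfolding boundary_values_def by (auto intro!: tendsto_intros continuous_intros)

text \<open>After multiplication by z, the \<open>X2\<close> term is O(1/z) and the remainder
  O(1/z^2), so both vanish in the limit. It is through this limit that the entry of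
  \<open>X1\<close> enters the final formula.\<close>

lemma X_RHP_expansion:
  assumes "X_RHP \<phi> n X X1 X2"
  obtains F where "\<And>i j. ((\<lambda>z. z * F z $ i $ j) \<longlongrightarrow> X1 $ i $ j) at_infinity"
    and "\<forall>\<^sub>F z in at_infinity. X z = (mat 1 + F z) ** zpow_sigma3 n z"
proof -
  obtain E where E: "mat_bigo_infinity E 3" and X: "\<forall>\<^sub>F z in at_infinity.
      X z = (mat 1 + (1 / z) \<cdot>\<^sub>m X1 + (1 / z\<^sup>2) \<cdot>\<^sub>m X2 + E z) ** zpow_sigma3 n z"
    using assms unfolding X_RHP_def by blast
  define F where "F z = (1 / z) \<cdot>\<^sub>m X1 + (1 / z\<^sup>2) \<cdot>\<^sub>m X2 + E z" for z
  have "((\<lambda>z. z * F z $ i $ j) \<longlongrightarrow> X1 $ i $ j) at_infinity" for i j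
  proof -
    have inv: "((\<lambda>z :: complex. 1 / z) \<longlongrightarrow> 0) at_infinity"
      using tendsto_inverse_0 by (simp add: divide_inverse)
    have "(\<lambda>z. z * E z $ i $ j) \<in> O[at_infinity](\<lambda>z. z * (1 / z ^ 3))"
      using E unfolding mat_bigo_infinity_def by (intro landau_o.big.mult_left) auto
    moreover have "(\<lambda>z :: complex. z * (1 / z ^ 3)) \<in> o[at_infinity](\<lambda>_. 1)"
    proof (rule smalloI_tendsto)
      have "((\<lambda>z :: complex. 1 / z * (1 / z)) \<longlongrightarrow> 0) at_infinity"
        using tendsto_mult[OF inv inv] by simp
      also have "(\<lambda>z :: complex. 1 / z * (1 / z)) = (\<lambda>z. z * (1 / z ^ 3) / 1)"
        by (auto simp: power3_eq_cube)
      finally show "((\<lambda>z :: complex. z * (1 / z ^ 3) / 1) \<longlongrightarrow> 0) at_infinity" .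
    qed auto
    ultimately have "(\<lambda>z. z * E z $ i $ j) \<in> o[at_infinity](\<lambda>_. 1)"
      by (rule landau_o.big_small_trans)
    then have "((\<lambda>z. z * E z $ i $ j) \<longlongrightarrow> 0) at_infinity"
      using smalloD_tendsto by fastforce
    then have "((\<lambda>z. X1 $ i $ j + 1 / z * X2 $ i $ j + z * E z $ i $ j)
        \<longlongrightarrow> X1 $ i $ j + 0 * X2 $ i $ j + 0) at_infinity"
      by (intro tendsto_intros inv)
    moreover have "\<forall>\<^sub>F z in at_infinity.
        X1 $ i $ j + 1 / z * X2 $ i $ j + z * E z $ i $ j = z * F z $ i $ j"
      using eventually_not_equal_at_infinity[of 0]
      by eventually_elim (simp add: F_def field_simps power2_eq_square)
    ultimately show ?thesis
      by (auto elim: Lim_transform_eventually)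
  qed
  then show thesis
    by (rule that) (use X in \<open>simp add: F_def add.assoc\<close>)
qed

text \<open>Here the remainder is only O(1/z), so z times it is bounded and need not
  converge.\<close>

lemma Z_RHP_expansion:
  assumes "Z_RHP \<phi> n Z"
  obtains F where "\<And>i j. (\<lambda>z. z * F z $ i $ j) \<in> O[at_infinity](\<lambda>_. 1)"
    and "\<forall>\<^sub>F z in at_infinity. Z z = (mat 1 + F z) ** zpow_sigma3 n z"
proof -
  obtain E where E: "mat_bigo_infinity E 1"
    and Z: "\<forall>\<^sub>F z in at_infinity. Z z = (mat 1 + E z) ** zpow_sigma3 n z"
    using assms unfolding Z_RHP_def by blast
  have "(\<lambda>z. z * E z $ i $ j) \<in> O[at_infinity](\<lambda>_. 1)" for i j
  proof -
    have "(\<lambda>z. z * E z $ i $ j) \<in> O[at_infinity](\<lambda>z. z * (1 / z ^ 1))"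
      using E unfolding mat_bigo_infinity_def by (intro landau_o.big.mult_left) auto
    also have "(\<lambda>z :: complex. z * (1 / z ^ 1)) \<in> O[at_infinity](\<lambda>_. 1)"
      by (rule bigoI[of _ 1]) simp
    finally show ?thesis .
  qed
  then show thesis
    using Z by (rule that)
qed

text \<open>First-column entries carry z^n and second-column entries 1 / z^n. Every product formed
  below pairs one of each, so these powers cancel.\<close>

lemma mat1_add_mult_zpow_nth:
  "((mat 1 + F) ** zpow_sigma3 n z) $ 1 $ 1 = (1 + F $ 1 $ 1) * z ^ n"
  "((mat 1 + F) ** zpow_sigma3 n z) $ 2 $ 1 = F $ 2 $ 1 * z ^ n"
  "((mat 1 + F) ** zpow_sigma3 n z) $ 1 $ 2 = F $ 1 $ 2 * (1 / z ^ n)"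
  "((mat 1 + F) ** zpow_sigma3 n z) $ 2 $ 2 = (1 + F $ 2 $ 2) * (1 / z ^ n)"
  by (simp_all add: matrix_mult_2_nth zpow_sigma3_def mat_def power_int_minus field_simps)

text \<open>The jump matrix has determinant 1, so the determinant of \<open>X\<close> does not jump;
  at infinity the powers of z cancel and it tends to 1. It follows that the adjugate of
  \<open>X\<close> is its inverse.\<close>

lemma det_X_eq_1:
  assumes X: "X_RHP \<phi> n X X1 X2" and z: "z \<notin> unit_circle"
  shows "X z $ 1 $ 1 * X z $ 2 $ 2 - X z $ 1 $ 2 * X z $ 2 $ 1 = 1"
proof -
  define d where "d A = A $ 1 $ 1 * A $ 2 $ 2 - A $ 1 $ 2 * A $ 2 $ 1" for A :: cmat2
  obtain Xp Xm where bv: "boundary_values X Xp Xm"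
    and ae: "ae_circle (\<lambda>z. Xp z = Xm z ** mat2 1 (z powi (- int n) * \<phi> z) 0 1)"
    using X unfolding X_RHP_def by blast
  note bvD = boundary_valuesD[OF bv]
  have "\<exists>g. g holomorphic_on UNIV \<and> (\<forall>z. z \<notin> unit_circle \<longrightarrow> g z = d (X z))"
  proof (rule entire_extension_across_circle)
    show "(\<lambda>z. d (X z)) analytic_on - unit_circle"
      using X unfolding X_RHP_def analytic_off_circle_def d_def
      by (auto intro!: analytic_intros)
    show "ae_circle (\<lambda>z. d (Xp z) = d (Xm z))"
      using ae unfolding ae_circle_def
      by eventually_elim (auto simp: d_def matrix_mult_2_nth algebra_simps)
  qed (auto simp: d_def intro!: tendsto_intros continuous_intros bvD)
  then obtain g where g: "g holomorphic_on UNIV" "\<And>z. z \<notin> unit_circle \<Longrightarrow> g z = d (X z)"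
    by blast
  obtain F where F: "\<And>i j. ((\<lambda>z. z * F z $ i $ j) \<longlongrightarrow> X1 $ i $ j) at_infinity"
    and XF: "\<forall>\<^sub>F z in at_infinity. X z = (mat 1 + F z) ** zpow_sigma3 n z"
    using X_RHP_expansion[OF X] by blast
  have F0: "((\<lambda>z. F z $ i $ j) \<longlongrightarrow> 0) at_infinity" for i j
    by (intro bigo_1_imp_tendsto_0_at_infinity bigoI_tendsto[where c = "X1 $ i $ j"]) (use F in auto)
  have "((\<lambda>z. (1 + F z $ 1 $ 1) * (1 + F z $ 2 $ 2) - F z $ 1 $ 2 * F z $ 2 $ 1)
      \<longlongrightarrow> (1 + 0) * (1 + 0) - 0 * 0) at_infinity"
    by (intro tendsto_intros F0)
  moreover have "\<forall>\<^sub>F z in at_infinity.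
      (1 + F z $ 1 $ 1) * (1 + F z $ 2 $ 2) - F z $ 1 $ 2 * F z $ 2 $ 1 = g z"
    using XF eventually_off_circle_at_infinity
  proof eventually_elim
    case (elim z)
    then show ?case
      by (simp add: g(2) d_def mat1_add_mult_zpow_nth)
  qed
  ultimately have "(g \<longlongrightarrow> 1) at_infinity"
    by (auto elim: Lim_transform_eventually)
  then have "g z = 1"
    using Liouville_weak g(1) by blast
  then show ?thesis
    using g(2)[OF z] by (simp add: d_def)
qed

section \<open>Comparison of the two solutions\<close>

theorem theorem1p8:
  fixes \<phi> :: "complex \<Rightarrow> complex" and n :: nat
    and X Z :: "complex \<Rightarrow> complex^2^2" and X1 X2 :: "complex^2^2"
  assumes "L1_circle \<phi>"
    and "X_RHP \<phi> n X X1 X2"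
    and "Z_RHP \<phi> n Z"
  shows "X 0 $ 1 $ 1 \<noteq> 0 \<and>
    (\<forall>z. z \<notin> unit_circle \<and> z \<noteq> 0 \<longrightarrow>
       Z z = ((1 / z) \<cdot>\<^sub>m mat2 (X1 $ 1 $ 2 * X 0 $ 2 $ 1 / X 0 $ 1 $ 1) (- (X1 $ 1 $ 2))
                             (- (X 0 $ 2 $ 1 / X 0 $ 1 $ 1)) 1
              + mat2 1 0 0 0) ** X z ** mat2 1 0 0 z)"
proof -
  obtain Xp Xm where bvX: "boundary_values X Xp Xm"
    and aeX: "ae_circle (\<lambda>z. Xp z = Xm z ** mat2 1 (z powi (- int n) * \<phi> z) 0 1)"
    using assms(2) unfolding X_RHP_def by blast
  obtain Zp Zm where bvZ: "boundary_values Z Zp Zm"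
    and aeZ: "ae_circle (\<lambda>z. Zp z = Zm z ** mat2 1 (z powi (- int n + 1) * \<phi> z) 0 1)"
    using assms(3) unfolding Z_RHP_def by blast
  have an: "(\<lambda>z. X z $ i $ j) analytic_on - unit_circle"
    "(\<lambda>z. Z z $ i $ j) analytic_on - unit_circle" for i j
    using assms unfolding X_RHP_def Z_RHP_def analytic_off_circle_def by auto
  \<comment> \<open>The jump of \<open>Z\<close> has one more factor z than that of
    \<open>X\<close>. Since \<open>a\<close> and \<open>b\<close> put a factor z on the first column
    of \<open>V\<close>, each of them receives the same \<open>\<phi>\<close> term twice, with
    opposite signs.\<close>
  have powi: "cis t powi (1 - int n) = cis t * cis t powi (- int n)" for t
    using power_int_add[of "cis t" "- int n" 1] by (simp add: mult.commute)
  \<comment> \<open>the two columns of \<open>Z diag(z, 1) adj X\<close>\<close>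
  define a b :: "complex \<Rightarrow> cmat2 \<Rightarrow> cmat2 \<Rightarrow> 2 \<Rightarrow> complex"
    where "a z V W i = z * V $ i $ 1 * W $ 2 $ 2 - V $ i $ 2 * W $ 2 $ 1"
      and "b z V W i = V $ i $ 2 * W $ 1 $ 1 - z * V $ i $ 1 * W $ 1 $ 2" for z V W i
  have "\<exists>g. g holomorphic_on UNIV \<and> (\<forall>z. z \<notin> unit_circle \<longrightarrow> g z = a z (Z z) (X z) i)" for i
  proof (rule entire_extension_across_circle)
    show "(\<lambda>z. a z (Z z) (X z) i) analytic_on - unit_circle"
      unfolding a_def by (intro analytic_intros an)
    show "ae_circle (\<lambda>z. a z (Zp z) (Xp z) i = a z (Zm z) (Xm z) i)"
      using aeX aeZ unfolding ae_circle_def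
      by eventually_elim (auto simp: a_def matrix_mult_2_nth powi algebra_simps)
  qed (auto simp: a_def intro!: tendsto_intros continuous_intros boundary_valuesD[OF bvX]
      boundary_valuesD[OF bvZ])
  then obtain A where A: "A i holomorphic_on UNIV"
    "z \<notin> unit_circle \<Longrightarrow> A i z = a z (Z z) (X z) i" for i z
    by metis
  have "\<exists>g. g holomorphic_on UNIV \<and> (\<forall>z. z \<notin> unit_circle \<longrightarrow> g z = b z (Z z) (X z) i)" for i
  proof (rule entire_extension_across_circle)
    show "(\<lambda>z. b z (Z z) (X z) i) analytic_on - unit_circle"
      unfolding b_def by (intro analytic_intros an)
    show "ae_circle (\<lambda>z. b z (Zp z) (Xp z) i = b z (Zm z) (Xm z) i)"
      using aeX aeZ unfolding ae_circle_def
      by eventually_elim (auto simp: b_def matrix_mult_2_nth powi algebra_simps)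
  qed (auto simp: b_def intro!: tendsto_intros continuous_intros boundary_valuesD[OF bvX]
      boundary_valuesD[OF bvZ])
  then obtain B where B: "B i holomorphic_on UNIV"
    "z \<notin> unit_circle \<Longrightarrow> B i z = b z (Z z) (X z) i" for i z
    by metis
  obtain F where zF: "\<And>i j. ((\<lambda>z. z * F z $ i $ j) \<longlongrightarrow> X1 $ i $ j) at_infinity"
    and XF: "\<forall>\<^sub>F z in at_infinity. X z = (mat 1 + F z) ** zpow_sigma3 n z"
    using X_RHP_expansion[OF assms(2)] by blast
  obtain H where zH: "\<And>i j. (\<lambda>z. z * H z $ i $ j) \<in> O[at_infinity](\<lambda>_. 1)"
    and ZH: "\<forall>\<^sub>F z in at_infinity. Z z = (mat 1 + H z) ** zpow_sigma3 n z"
    using Z_RHP_expansion[OF assms(3)] by blast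
  have zF1: "(\<lambda>z. z * F z $ i $ j) \<in> O[at_infinity](\<lambda>_. 1)" for i j
    by (rule bigoI_tendsto[where c = "X1 $ i $ j"]) (use zF in auto)
  have F0: "((\<lambda>z. F z $ i $ j) \<longlongrightarrow> 0) at_infinity" for i j
    using zF1 by (rule bigo_1_imp_tendsto_0_at_infinity)
  have H0: "((\<lambda>z. H z $ i $ j) \<longlongrightarrow> 0) at_infinity" for i j
    using zH by (rule bigo_1_imp_tendsto_0_at_infinity)
  have F1: "(\<lambda>z. F z $ i $ j) \<in> O[at_infinity](\<lambda>_. 1)" for i j
    by (rule bigoI_tendsto[where c = 0]) (use F0 in auto)
  have H1: "(\<lambda>z. H z $ i $ j) \<in> O[at_infinity](\<lambda>_. 1)" for i j
    by (rule bigoI_tendsto[where c = 0]) (use H0 in auto)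
  \<comment> \<open>The factor z is attached to single entries of \<open>H\<close> or
    \<open>F\<close>, so that every factor has a known bound or limit. Only \<open>A 1\<close>
    grows, with leading term z from the identity parts of both expansions.\<close>
  have ev: "\<forall>\<^sub>F z in at_infinity.
      A 1 z - z = (z * H z $ 1 $ 1) * (1 + F z $ 2 $ 2) + z * F z $ 2 $ 2 - H z $ 1 $ 2 * F z $ 2 $ 1 \<and>
      A 2 z = (z * H z $ 2 $ 1) * (1 + F z $ 2 $ 2) - (1 + H z $ 2 $ 2) * F z $ 2 $ 1 \<and>
      B 1 z = H z $ 1 $ 2 * (1 + F z $ 1 $ 1) - (1 + H z $ 1 $ 1) * (z * F z $ 1 $ 2) \<and>
      B 2 z = (1 + H z $ 2 $ 2) * (1 + F z $ 1 $ 1) - H z $ 2 $ 1 * (z * F z $ 1 $ 2)"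
    using XF ZH eventually_off_circle_at_infinity
  proof eventually_elim
    case (elim z)
    then show ?case
      by (simp add: A(2) B(2) a_def b_def mat1_add_mult_zpow_nth) (simp add: algebra_simps)
  qed
  have "(\<lambda>z. (z * H z $ 1 $ 1) * (1 + F z $ 2 $ 2) + z * F z $ 2 $ 2 - H z $ 1 $ 2 * F z $ 2 $ 1)
      \<in> O[at_infinity](\<lambda>_. 1)"
    by (intro sum_in_bigo landau_o.big.mult_in_1 zH zF1 F1 H1 bigo_const)
  then have "(\<lambda>z. A 1 z - z) \<in> O[at_infinity](\<lambda>_. 1)"
    by (rule landau_o.big.in_cong[THEN iffD2, rotated]) (use ev in \<open>auto elim: eventually_mono\<close>)
  then have A1: "A 1 z - z = A 1 0" for z
    using entire_bigo_1_constant[of "\<lambda>z. A 1 z - z" z 0]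
    by (simp add: holomorphic_on_diff[OF A(1)])
  have "(\<lambda>z. (z * H z $ 2 $ 1) * (1 + F z $ 2 $ 2) - (1 + H z $ 2 $ 2) * F z $ 2 $ 1)
      \<in> O[at_infinity](\<lambda>_. 1)"
    by (intro sum_in_bigo landau_o.big.mult_in_1 zH F1 H1 bigo_const)
  then have "A 2 \<in> O[at_infinity](\<lambda>_. 1)"
    by (rule landau_o.big.in_cong[THEN iffD2, rotated]) (use ev in \<open>auto elim: eventually_mono\<close>)
  then have A2: "A 2 z = A 2 0" for z
    by (rule entire_bigo_1_constant[OF A(1)])
  \<comment> \<open>In the second column z multiplies only entries of \<open>F\<close>, never of
    \<open>H\<close>, so a genuine limit exists and fixes the constant.\<close>
  have "((\<lambda>z. H z $ 1 $ 2 * (1 + F z $ 1 $ 1) - (1 + H z $ 1 $ 1) * (z * F z $ 1 $ 2))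
      \<longlongrightarrow> 0 * (1 + 0) - (1 + 0) * X1 $ 1 $ 2) at_infinity"
    by (intro tendsto_intros F0 H0 zF)
  then have "(B 1 \<longlongrightarrow> - (X1 $ 1 $ 2)) at_infinity"
    by (rule Lim_transform_eventually[THEN tendsto_eq_rhs])
      (use ev in \<open>auto elim: eventually_mono\<close>)
  then have B1: "B 1 z = - (X1 $ 1 $ 2)" for z
    by (rule Liouville_weak[OF B(1)])
  have "((\<lambda>z. (1 + H z $ 2 $ 2) * (1 + F z $ 1 $ 1) - H z $ 2 $ 1 * (z * F z $ 1 $ 2))
      \<longlongrightarrow> (1 + 0) * (1 + 0) - 0 * X1 $ 1 $ 2) at_infinity"
    by (intro tendsto_intros F0 H0 zF)
  then have "(B 2 \<longlongrightarrow> 1) at_infinity"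
    by (rule Lim_transform_eventually[THEN tendsto_eq_rhs])
      (use ev in \<open>auto elim: eventually_mono\<close>)
  then have B2: "B 2 z = 1" for z
    by (rule Liouville_weak[OF B(1)])
  \<comment> \<open>At 0 the terms of \<open>b\<close> with a factor z drop out. The value 1 of the
    second product forces \<open>X 0 $ 1 $ 1\<close> to be nonzero; dividing by it gives the second
    column of \<open>Z 0\<close>, and hence the constants \<open>A 1 0\<close> and
    \<open>A 2 0\<close>.\<close>
  have B_0: "Z 0 $ 1 $ 2 * X 0 $ 1 $ 1 = - (X1 $ 1 $ 2)" "Z 0 $ 2 $ 2 * X 0 $ 1 $ 1 = 1"
    using B(2)[of 0] B1[of 0] B2[of 0] by (auto simp: b_def)
  then have nz: "X 0 $ 1 $ 1 \<noteq> 0"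
    by auto
  have A_0: "A 1 0 = X1 $ 1 $ 2 * X 0 $ 2 $ 1 / X 0 $ 1 $ 1" "A 2 0 = - (X 0 $ 2 $ 1 / X 0 $ 1 $ 1)"
  proof -
    have "A i 0 = - Z 0 $ i $ 2 * X 0 $ 2 $ 1" for i
      using A(2)[of 0] by (simp add: a_def)
    moreover have "Z 0 $ 1 $ 2 = - (X1 $ 1 $ 2) / X 0 $ 1 $ 1" "Z 0 $ 2 $ 2 = 1 / X 0 $ 1 $ 1"
      using B_0 by (simp_all only: nonzero_eq_divide_eq[OF nz])
    ultimately show "A 1 0 = X1 $ 1 $ 2 * X 0 $ 2 $ 1 / X 0 $ 1 $ 1"
      "A 2 0 = - (X 0 $ 2 $ 1 / X 0 $ 1 $ 1)"
      by simp_all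
  qed
  show ?thesis
  proof (intro conjI allI impI nz)
    fix z :: complex
    assume z: "z \<notin> unit_circle \<and> z \<noteq> 0"
    have det: "X z $ 1 $ 1 * X z $ 2 $ 2 - X z $ 1 $ 2 * X z $ 2 $ 1 = 1"
      using det_X_eq_1[OF assms(2)] z by blast
    \<comment> \<open>Multiplying \<open>Z diag(z, 1) adj X\<close> on the right by \<open>X\<close>
      recovers \<open>Z diag(z, 1)\<close>, because adj X times X is the identity when the
      determinant is 1.\<close>
    have "z * Z z $ i $ 1 = A i z * X z $ 1 $ 1 + B i z * X z $ 2 $ 1"
      "Z z $ i $ 2 = A i z * X z $ 1 $ 2 + B i z * X z $ 2 $ 2" for i
      using det z unfolding A(2)[OF conjunct1[OF z]] B(2)[OF conjunct1[OF z]] a_def b_def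
      by algebra+
    then have col: "Z z $ i $ 1 = (A i z * X z $ 1 $ 1 + B i z * X z $ 2 $ 1) / z"
      "Z z $ i $ 2 = A i z * X z $ 1 $ 2 + B i z * X z $ 2 $ 2" for i
      using z by (metis nonzero_mult_div_cancel_left)+
    have Az: "A 1 z = z + A 1 0" "A 2 z = A 2 0"
      using A1[of z] A2[of z] by (simp_all add: algebra_simps)
    show "Z z = ((1 / z) \<cdot>\<^sub>m mat2 (X1 $ 1 $ 2 * X 0 $ 2 $ 1 / X 0 $ 1 $ 1) (- (X1 $ 1 $ 2))
        (- (X 0 $ 2 $ 1 / X 0 $ 1 $ 1)) 1 + mat2 1 0 0 0) ** X z ** mat2 1 0 0 z"
      \<comment> \<open>Since diag(1/z, 1) is 1/z times diag(1, z), division by z turns the linear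
        term of \<open>A 1 z\<close> into the constant matrix \<open>mat2 1 0 0 0\<close>.\<close>
      unfolding cmat2_eq_iff forall_2 A_0[symmetric]
      using z by (simp add: matrix_mult_2_nth col Az B1 B2 field_simps)
  qed
qed

end
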